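(* For all integers $d_1, d_2 \ge 0$, the Cartesian product $K^{d_1+1}\times K^{d_2+1}$ of the complete graphs $K^{d_1+1}$ and $K^{d_2+1}$ is $\lfloor (d_1+d_2)/2\rfloor$-linked.
   Context: $K^{t}$ denotes the complete graph on $t$ vertices. The Cartesian product $G_1\times G_2$ of two graphs is the graph whose vertices are the pairs $(v_1,v_2)$ with $v_i\in V(G_i)$, where $(u_1,u_2)$ and $(v_1,v_2)$ are adjacent if, for some $\ell\in\{1,2\}$, $u_\ell v_\ell\in E(G_\ell)$ and $u_i=v_i$ for $i\neq \ell$. For an integer $k\ge 0$, a graph $G$ is $k$-linked if it has at least $2k$ vertices and, for every set $X$ of exactly $2k$ distinct vertices of $G$ and every partition of $X$ into pairs $\{s_1,t_1\},\ldots,\{s_k,t_k\}$, there exist $k$ pairwise vertex-disjoint paths $L_1,\ldots,L_k$ in $G$ such that $L_i$ joins $s_i$ to $t_i$ for each $i\in\{1,\ldots,k\}$ (for $k=0$ the condition is vacuous). *)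

theory Defs
  imports "Graph_Theory.Graph_Theory" "HOL-Library.Disjoint_Sets"
begin

text \<open>
  Finite simple graphs are represented by the symmetric, loop-free digraphs without parallel arcs
  of \<^locale>\<open>pair_graph\<close> and \<^locale>\<open>graph\<close>: an edge $uv$ is the pair of arcs
  $(u,v)$ and $(v,u)$.
\<close>

definition cartesian_product ::
    "'a pair_pre_digraph \<Rightarrow> 'b pair_pre_digraph \<Rightarrow> ('a \<times> 'b) pair_pre_digraph" where
  "cartesian_product G1 G2 =
     \<lparr> pverts = pverts G1 \<times> pverts G2,
       parcs = {((u1, u2), (v1, v2)) | u1 u2 v1 v2.
         (u1, u2) \<in> pverts G1 \<times> pverts G2 \<and> (v1, v2) \<in> pverts G1 \<times> pverts G2 \<and>
         ((u1, v1) \<in> parcs G1 \<and> u2 = v2 \<or> u1 = v1 \<and> (u2, v2) \<in> parcs G2)} \<rparr>"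

lemma pair_graph_cartesian_product:
  assumes "pair_graph G1" and "pair_graph G2"
  shows "pair_graph (cartesian_product G1 G2)"
proof -
  interpret G1: pair_graph G1 by fact
  interpret G2: pair_graph G2 by fact
  let ?V = "pverts G1 \<times> pverts G2"
  have fin: "finite ?V"
    using G1.pair_finite_verts G2.pair_finite_verts by simp
  have "parcs (cartesian_product G1 G2) \<subseteq> ?V \<times> ?V"
    by (auto simp: cartesian_product_def)
  then have "finite (parcs (cartesian_product G1 G2))"
    using fin by (meson finite_SigmaI finite_subset)
  moreover have "sym (parcs G1)" "sym (parcs G2)"
    using G1.pair_sym_arcs G2.pair_sym_arcs by (simp_all add: symmetric_def)
  then have "sym (parcs (cartesian_product G1 G2))"
    by (auto simp: cartesian_product_def sym_def)
  ultimately show ?thesis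
    using fin
    by unfold_locales
      (auto simp: cartesian_product_def symmetric_def dest: G1.pair_no_loops G2.pair_no_loops)
qed

text \<open>
  The family of pairs \<open>{s i, t i}\<close>, for \<open>i\<close> in \<open>{1..k}\<close>, is the given partition of \<open>X\<close>.
  As graphs are finite, \<^const>\<open>card\<close> is the true number of vertices. For \<open>s i \<noteq> t i\<close>, a
  duplicate-free vertex list from \<open>s i\<close> to \<open>t i\<close> is an undirected path.
\<close>

definition linked :: "nat \<Rightarrow> ('a, 'b) pre_digraph \<Rightarrow> bool" where
  "linked k G \<longleftrightarrow>
     2 * k \<le> card (verts G) \<and>
     (\<forall>X s t.
        X \<subseteq> verts G \<and> card X = 2 * k \<and>
        (\<Union>i\<in>{1..k}. {s i, t i}) = X \<and>
        disjoint_family_on (\<lambda>i. {s i, t i}) {1..k} \<and>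
        (\<forall>i\<in>{1..k}. s i \<noteq> t i)
        \<longrightarrow> (\<exists>L. (\<forall>i\<in>{1..k}. vpath (L i) G \<and> hd (L i) = s i \<and> last (L i) = t i) \<and>
                 disjoint_family_on (\<lambda>i. set (L i)) {1..k}))"

end

theory Submission
  imports Defs
begin

text \<open>
  The vertices are the cells of a grid with rows \<open>R\<close> and columns \<open>C\<close>, two cells being adjacent if
  they share a line. By induction on \<open>|R| + |C|\<close> we link \<open>k\<close> pairs of terminals while
  avoiding a set \<open>B\<close> of blocked cells, as long as \<open>2 k + |B| \<le> |R| + |C| - 2\<close>. Under this bound
  there cannot be both a full row and a full column.

  Adjacent terminals are linked and become blocked. If no terminals of a pair are adjacent and a
  blocked cell exists, its row (if no column is full) or its column (if no row is full) is deleted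
  after moving its terminals out of it perpendicularly. If nothing is blocked and some pair has a
  free corner in its bounding rectangle, link it through that corner and delete a line in the same
  way.

  Otherwise every nonempty line contains two terminals, so some line, say a column, is empty. Link
  a pair through it and delete the two rows of that pair. Terminals in these rows that have no room
  in their own column first move to other empty columns; counting shows that there are enough of
  these if the pair meets the most crowded columns. With only two rows there are as many empty
  columns as pairs, and each pair uses its own.
\<close>

section \<open>Paths and linkages among the cells of a grid\<close>

definition rook_adj :: "'a \<times> 'b \<Rightarrow> 'a \<times> 'b \<Rightarrow> bool" where
  "rook_adj u v \<longleftrightarrow> u \<noteq> v \<and> (fst u = fst v \<or> snd u = snd v)"

lemma rook_adj_commute: "rook_adj u v \<longleftrightarrow> rook_adj v u"
  by (auto simp: rook_adj_def)

lemma rook_adj_swap: "rook_adj (prod.swap u) (prod.swap v) \<longleftrightarrow> rook_adj u v"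
  by (cases u; cases v) (auto simp: rook_adj_def)

definition rook_path :: "('a \<times> 'b) set \<Rightarrow> ('a \<times> 'b) list \<Rightarrow> 'a \<times> 'b \<Rightarrow> 'a \<times> 'b \<Rightarrow> bool" where
  "rook_path V xs u v \<longleftrightarrow> xs \<noteq> [] \<and> distinct xs \<and> successively rook_adj xs \<and> set xs \<subseteq> V \<and>
     hd xs = u \<and> last xs = v"

text \<open>The terminals of the pair with index \<open>i\<close> are \<open>p (i, True)\<close> and \<open>p (i, False)\<close>.\<close>

abbreviation terminals :: "nat set \<Rightarrow> (nat \<times> bool \<Rightarrow> 'c) \<Rightarrow> 'c set" where
  "terminals I p \<equiv> p ` (I \<times> UNIV)"

text \<open>An arbitrary index set \<open>I\<close> instead of an initial segment lets a pair be
  dropped without renumbering the others: the sub-problem uses \<open>I - {i}\<close> with the same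
  \<open>p\<close>.\<close>

definition linkage :: "('a \<times> 'b) set \<Rightarrow> nat set \<Rightarrow> (nat \<times> bool \<Rightarrow> 'a \<times> 'b) \<Rightarrow> bool" where
  "linkage V I p \<longleftrightarrow> (\<exists>L. (\<forall>i\<in>I. rook_path V (L i) (p (i, True)) (p (i, False))) \<and>
     disjoint_family_on (\<lambda>i. set (L i)) I)"

definition linkable :: "('a \<times> 'b) set \<Rightarrow> nat set \<Rightarrow> bool" where
  "linkable V I \<longleftrightarrow>
     (\<forall>p. inj_on p (I \<times> UNIV) \<and> terminals I p \<subseteq> V \<longrightarrow> linkage V I p)"

lemma rook_path_mono: "rook_path V xs u v \<Longrightarrow> V \<subseteq> W \<Longrightarrow> rook_path W xs u v"
  by (auto simp: rook_path_def)

lemma rook_path_rev: "rook_path V xs u v \<Longrightarrow> rook_path V (rev xs) v u"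
  by (auto simp: rook_path_def hd_rev last_rev rook_adj_commute cong: successively_cong)

lemma rook_path_Cons:
  assumes "rook_path (V - {w}) xs u v" "rook_adj w u" "w \<in> V"
  shows "rook_path V (w # xs) w v"
  using assms by (cases xs) (auto simp: rook_path_def)

lemma linkage_empty [simp]: "linkage V {} p"
  by (auto simp: linkage_def disjoint_family_on_def)

lemma linkage_mono: "linkage V I p \<Longrightarrow> V \<subseteq> W \<Longrightarrow> linkage W I p"
  unfolding linkage_def using rook_path_mono by meson

text \<open>Peels off one pair: the other paths live outside \<open>set xs\<close>, so disjointness
  is automatic. The parameter \<open>b\<close> lets \<open>xs\<close> start at either terminal,
  which leaves later constructions free to choose the orientation.\<close>

lemma linkage_join:
  assumes i: "i \<in> I" and xs: "rook_path V xs (p (i, b)) (p (i, \<not> b))"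
    and link: "linkage (V - set xs) (I - {i}) p"
  shows "linkage V I p"
proof -
  obtain ys where ys: "rook_path V ys (p (i, True)) (p (i, False))" "set ys = set xs"
  proof (cases b)
    case True
    then show ?thesis using xs that by auto
  next
    case False
    then show ?thesis using rook_path_rev[OF xs] that[of "rev xs"] by auto
  qed
  obtain L where L: "\<forall>j\<in>I - {i}. rook_path (V - set xs) (L j) (p (j, True)) (p (j, False))"
    "disjoint_family_on (\<lambda>j. set (L j)) (I - {i})"
    using link by (auto simp: linkage_def)
  have avoid: "set (L j) \<inter> set ys = {}" if "j \<in> I" "j \<noteq> i" for j
    using L(1) that ys(2) by (auto simp: rook_path_def)
  have "\<forall>j\<in>I. rook_path V ((L(i := ys)) j) (p (j, True)) (p (j, False))"
    using L(1) ys(1) rook_path_mono[of "V - set xs" _ _ _ V] by auto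
  moreover have "disjoint_family_on (\<lambda>j. set ((L(i := ys)) j)) I"
    using L(2) avoid by (auto simp: disjoint_family_on_def)
  ultimately show ?thesis
    unfolding linkage_def by blast
qed

text \<open>The old position \<open>p x\<close> is deleted from the grid of the moved problem. Hence
  attaching it to the end of its path at \<open>v\<close> keeps that path simple and disjoint from
  all others.\<close>

lemma linkage_move:
  assumes x: "x \<in> I \<times> UNIV" and inj: "inj_on p (I \<times> UNIV)" and px: "p x \<in> V"
    and adj: "rook_adj (p x) v"
    and link: "linkage (V - {p x}) I (p(x := v))"
  shows "linkage V I p"
proof -
  obtain i b where xib: "x = (i, b)" "i \<in> I"
    using x by auto
  obtain L where L: "\<forall>j\<in>I. rook_path (V - {p x}) (L j) ((p(x := v)) (j, True)) ((p(x := v)) (j, False))"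
    "disjoint_family_on (\<lambda>j. set (L j)) I"
    using link by (auto simp: linkage_def)
  obtain ys where ys: "rook_path V ys (p (i, True)) (p (i, False))" "set ys = insert (p x) (set (L i))"
  proof (cases b)
    case True
    then have "rook_path (V - {p x}) (L i) v (p (i, False))"
      using L(1) xib by auto
    from rook_path_Cons[OF this adj px] show ?thesis
      using that[of "p x # L i"] True xib by auto
  next
    case False
    then have "rook_path (V - {p x}) (L i) (p (i, True)) v"
      using L(1) xib by auto
    then have "rook_path (V - {p x}) (rev (L i)) v (p (i, True))"
      by (rule rook_path_rev)
    from rook_path_rev[OF rook_path_Cons[OF this adj px]] show ?thesis
      using that[of "rev (p x # rev (L i))"] False xib by auto
  qed
  have "\<forall>j\<in>I. rook_path V ((L(i := ys)) j) (p (j, True)) (p (j, False))"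
  proof
    fix j
    assume "j \<in> I"
    show "rook_path V ((L(i := ys)) j) (p (j, True)) (p (j, False))"
    proof (cases "j = i")
      case False
      then have "rook_path (V - {p x}) (L j) (p (j, True)) (p (j, False))"
        using L(1) \<open>j \<in> I\<close> xib(1) by auto
      then show ?thesis
        using False by (auto intro: rook_path_mono)
    qed (use ys in simp)
  qed
  moreover have "p x \<notin> set (L j)" if "j \<in> I" for j
    using L(1) that by (auto simp: rook_path_def)
  then have "disjoint_family_on (\<lambda>j. set ((L(i := ys)) j)) I"
    using L(2) ys(2) xib(2) by (auto simp: disjoint_family_on_def)
  ultimately show ?thesis
    unfolding linkage_def by blast
qed

text \<open>Transposition of the grid; thanks to it, the deletion arguments need to be carried out
  for rows only.\<close>

lemma linkage_swap:
  assumes "linkage (prod.swap ` V) I (prod.swap \<circ> p)"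
  shows "linkage V I p"
proof -
  obtain L where L:
    "\<forall>i\<in>I. rook_path (prod.swap ` V) (L i) (prod.swap (p (i, True))) (prod.swap (p (i, False)))"
    "disjoint_family_on (\<lambda>i. set (L i)) I"
    using assms by (auto simp: linkage_def)
  have "rook_path V (map prod.swap (L i)) (p (i, True)) (p (i, False))" if "i \<in> I" for i
    using L(1)[rule_format, OF that]
    by (auto simp: rook_path_def distinct_map successively_map rook_adj_swap hd_map last_map
        inj_on_def)
  moreover have "disjoint_family_on (\<lambda>i. set (map prod.swap (L i))) I"
    using L(2) by (fastforce simp: disjoint_family_on_def)
  ultimately show ?thesis
    unfolding linkage_def by (intro exI[of _ "\<lambda>i. map prod.swap (L i)"]) auto
qed

section \<open>Counting cells column by column\<close>

definition column_count :: "('a \<times> 'b) set \<Rightarrow> 'b \<Rightarrow> nat" where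
  "column_count T d = card {r. (r, d) \<in> T}"

lemma finite_column: "finite T \<Longrightarrow> finite {r. (r, d) \<in> T}"
  by (rule finite_subset[of _ "fst ` T"]) force+

lemma column_count_eq_0: "(\<And>r. (r, d) \<notin> T) \<Longrightarrow> column_count T d = 0"
  by (simp add: column_count_def)

lemma column_count_pos: "finite T \<Longrightarrow> 0 < column_count T d \<longleftrightarrow> (\<exists>r. (r, d) \<in> T)"
  by (simp add: column_count_def card_gt_0_iff finite_column)

lemma column_count_insert:
  "finite T \<Longrightarrow> (r, c) \<notin> T \<Longrightarrow>
    column_count (insert (r, c) T) d = column_count T d + (if d = c then 1 else 0)"
proof -
  assume T: "finite T" "(r, c) \<notin> T"
  have "{r'. (r', d) \<in> insert (r, c) T} = (if d = c then insert r {r'. (r', d) \<in> T} else {r'. (r', d) \<in> T})"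
    by auto
  with T show ?thesis
    by (simp add: column_count_def finite_column)
qed

lemma column_count_remove:
  assumes "finite T" "(r, c) \<in> T"
  shows "column_count T d = column_count (T - {(r, c)}) d + (if d = c then 1 else 0)"
  using column_count_insert[of "T - {(r, c)}" r c d] assms by (simp add: insert_absorb)

lemma card_eq_sum_column_count:
  assumes "finite T" "finite C" "T \<subseteq> UNIV \<times> C"
  shows "card T = (\<Sum>d\<in>C. column_count T d)"
proof -
  have "card T = card (prod.swap ` T)"
    by (simp add: card_image)
  also have "prod.swap ` T = (SIGMA d:C. {r. (r, d) \<in> T})"
    using assms(3) by force
  also have "card \<dots> = (\<Sum>d\<in>C. column_count T d)"
    using assms by (simp add: column_count_def finite_column)
  finally show ?thesis .
qed

section \<open>Moving terminals out of rows that are to be deleted\<close>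

lemma terminals_fun_upd:
  assumes "inj_on p (I \<times> UNIV)" "x \<in> I \<times> UNIV"
  shows "terminals I (p(x := v)) = insert v (terminals I p - {p x})"
proof -
  have "p ` (I \<times> UNIV - {x}) = terminals I p - {p x}"
    using assms by (auto simp: inj_on_def)
  moreover have "terminals I (p(x := v)) = insert v (p ` (I \<times> UNIV - {x}))"
    using assms(2) by (auto simp: image_iff)
  ultimately show ?thesis by simp
qed

lemma inj_on_terminals_fun_upd:
  assumes "inj_on p (I \<times> UNIV)" "v \<notin> terminals I p"
  shows "inj_on (p(x := v)) (I \<times> UNIV)"
  using assms by (auto simp: inj_on_def)

text \<open>Any two cells of a column are adjacent, so a terminal leaves the rows \<open>Q\<close>
  in one step. The vacated cell lies in such a row, so \<open>W\<close> never changes when it is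
  deleted from \<open>V\<close>. A move lowers both sides of \<open>room\<close> by one in its own
  column and leaves the other columns alone; the induction is on the number of terminals still in
  the rows \<open>Q\<close>.\<close>

lemma linkage_evacuate_vertically:
  assumes "finite I" "inj_on p (I \<times> UNIV)" "terminals I p \<subseteq> V" "finite V"
    and link: "linkable W I" and W: "W = V - Q \<times> UNIV"
    and room: "\<And>d. column_count (terminals I p \<inter> Q \<times> UNIV) d \<le> column_count (W - terminals I p) d"
  shows "linkage V I p"
  using assms
proof (induction "card (terminals I p \<inter> Q \<times> UNIV)" arbitrary: p V)
  case 0
  then have "terminals I p \<subseteq> W"
    by auto
  then have "linkage W I p"
    using 0 by (auto simp: linkable_def)
  then show ?case
    using 0(7) linkage_mono by blast
next
  case (Suc n)
  let ?T = "terminals I p"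
  have finT: "finite ?T" and finW: "finite W"
    using Suc.prems by auto
  have "?T \<inter> Q \<times> UNIV \<noteq> {}"
    using Suc.hyps(2) by force
  then obtain q d where "(q, d) \<in> ?T" and q: "q \<in> Q"
    by auto
  then obtain x where x: "x \<in> I \<times> UNIV" "p x = (q, d)" "q \<in> Q"
    by (metis imageE)
  have qd: "(q, d) \<in> ?T \<inter> Q \<times> UNIV"
    using x by (metis IntI UNIV_I imageI mem_Sigma_iff)
  then have "0 < column_count (?T \<inter> Q \<times> UNIV) d"
    using finT by (auto simp: column_count_pos)
  then have "0 < column_count (W - ?T) d"
    using Suc.prems(7)[of d] by linarith
  then obtain r where r: "(r, d) \<in> W" "(r, d) \<notin> ?T"
    using finW by (auto simp: column_count_pos)
  have rQ: "r \<notin> Q"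
    using r Suc.prems(6) by auto
  let ?p = "p(x := (r, d))"
  have T': "terminals I ?p = insert (r, d) (?T - {(q, d)})"
    using terminals_fun_upd[OF Suc.prems(2) x(1)] x(2) by simp
  have TQ: "terminals I ?p \<inter> Q \<times> UNIV = (?T \<inter> Q \<times> UNIV) - {(q, d)}"
    unfolding T' using rQ by auto
  have TW: "W - terminals I ?p = (W - ?T) - {(r, d)}"
    unfolding T' using x(3) Suc.prems(6) by auto
  show ?case
  proof (rule linkage_move[OF x(1)])
    show "inj_on p (I \<times> UNIV)" by fact
    show "p x \<in> V"
      using x Suc.prems(3) by blast
    show "rook_adj (p x) (r, d)"
      using x rQ by (auto simp: rook_adj_def)
    show "linkage (V - {p x}) I ?p"
    proof (rule Suc.hyps(1))
      show "n = card (terminals I ?p \<inter> Q \<times> UNIV)"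
        unfolding TQ using Suc.hyps(2) qd finT by (simp add: card_Diff_singleton)
      show "inj_on ?p (I \<times> UNIV)"
        by (rule inj_on_terminals_fun_upd) (use Suc.prems r in auto)
      show "terminals I ?p \<subseteq> V - {p x}"
        unfolding T' using x r rQ Suc.prems by auto
      show "W = V - {p x} - Q \<times> UNIV"
        using x Suc.prems(6) by auto
      show "column_count (terminals I ?p \<inter> Q \<times> UNIV) d' \<le> column_count (W - terminals I ?p) d'" for d'
        unfolding TQ TW
        using Suc.prems(7)[of d'] column_count_remove[OF _ qd, of d']
          column_count_remove[of "W - ?T" r d d'] finT finW r
        by auto
    qed (use Suc.prems in auto)
  qed
qed

text \<open>Terminals for which there is no room in their own column first move, within their row, to one
  of the empty columns in \<open>K\<close>.\<close>

lemma linkage_evacuate: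
  assumes "finite I" "inj_on p (I \<times> UNIV)" "terminals I p \<subseteq> V" "finite V"
    and link: "linkable W I" and W: "W = V - Q \<times> UNIV" and C: "finite C" "V \<subseteq> UNIV \<times> C"
    and K: "K \<subseteq> C" "Q \<times> K \<subseteq> V" "terminals I p \<inter> Q \<times> K = {}"
      "\<And>c. c \<in> K \<Longrightarrow> 0 < column_count (W - terminals I p) c"
    and room: "(\<Sum>d\<in>C. column_count (terminals I p \<inter> Q \<times> UNIV) d
      - column_count (W - terminals I p) d) \<le> card K"
  shows "linkage V I p"
  using assms
proof (induction "card K" arbitrary: p V K)
  case 0
  let ?T = "terminals I p"
  have "column_count (?T \<inter> Q \<times> UNIV) d \<le> column_count (W - ?T) d" for d
  proof (cases "d \<in> C")
    case True
    then show ?thesis using 0 by simp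
  next
    case False
    then have "column_count (?T \<inter> Q \<times> UNIV) d = 0"
      using 0 by (intro column_count_eq_0) blast
    then show ?thesis by simp
  qed
  then show ?case
    using linkage_evacuate_vertically[of I p V W Q] 0 by blast
next
  case (Suc n)
  let ?T = "terminals I p"
  let ?dem = "\<lambda>p. column_count (terminals I p \<inter> Q \<times> UNIV)"
  let ?free = "\<lambda>p. column_count (W - terminals I p)"
  have finT: "finite ?T" and finW: "finite W"
    using Suc.prems by auto
  show ?case
  proof (cases "\<forall>d\<in>C. ?dem p d \<le> ?free p d")
    case True
    have "?dem p d \<le> ?free p d" for d
    proof (cases "d \<in> C")
      case False
      then have "?dem p d = 0"
        using Suc.prems by (intro column_count_eq_0) blast
      then show ?thesis by simp
    qed (use True in blast)
    then show ?thesis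
      using linkage_evacuate_vertically[of I p V W Q] Suc.prems by blast
  next
    case False
    then obtain d where d: "d \<in> C" "?free p d < ?dem p d"
      by (auto simp: not_le)
    then have "0 < ?dem p d" by linarith
    then obtain q where qd: "(q, d) \<in> ?T \<inter> Q \<times> UNIV"
      using finT by (auto simp: column_count_pos)
    then obtain x where x: "x \<in> I \<times> UNIV" "p x = (q, d)" and q: "q \<in> Q"
      by (metis IntD1 IntD2 SigmaD1 imageE)
    obtain c where c: "c \<in> K"
      using Suc.hyps(2) by (metis card.empty ex_in_conv nat.distinct(1))
    have qc: "(q, c) \<in> V" "(q, c) \<notin> ?T"
      using c q Suc.prems(10,11) by auto
    have cd: "c \<noteq> d"
      using qd qc by auto
    have finK: "finite K"
      using Suc.hyps(2) by (metis card.infinite nat.distinct(1))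
    let ?p = "p(x := (q, c))"
    have T': "terminals I ?p = insert (q, c) (?T - {(q, d)})"
      using terminals_fun_upd[OF Suc.prems(2) x(1)] x(2) by simp
    have TQ: "terminals I ?p \<inter> Q \<times> UNIV = insert (q, c) ((?T \<inter> Q \<times> UNIV) - {(q, d)})"
      unfolding T' using q by auto
    have TW: "W - terminals I ?p = W - ?T"
      unfolding T' using q Suc.prems(6) by auto
    have dem: "?dem ?p d' = ?dem p d' - (if d' = d then 1 else 0) + (if d' = c then 1 else 0)" for d'
      unfolding TQ
      using column_count_remove[OF _ qd, of d'] finT qc
        column_count_insert[of "(?T \<inter> Q \<times> UNIV) - {(q, d)}" q c d']
      by auto
    \<comment> \<open>The arrival of one terminal creates no deficit in \<open>c\<close>: that
      column had no terminal to evacuate and has at least one free cell in \<open>W\<close>.\<close>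
    have "?dem p c = 0"
      using Suc.prems(11) c by (intro column_count_eq_0) blast
    moreover have "0 < ?free p c"
      using Suc.prems(12) c by blast
    ultimately have le: "?dem ?p d' - ?free p d' \<le> ?dem p d' - ?free p d'" for d'
      using dem[of d'] cd by auto
    have lt: "?dem ?p d - ?free p d < ?dem p d - ?free p d"
      using dem[of d] cd d by auto
    \<comment> \<open>The total deficit drops by at least one, which matches the loss of the column
      \<open>c\<close> from \<open>K\<close>.\<close>
    have less: "(\<Sum>d\<in>C. ?dem ?p d - ?free p d) < (\<Sum>d\<in>C. ?dem p d - ?free p d)"
    proof (rule sum_strict_mono_ex1)
      show "\<exists>d\<in>C. ?dem ?p d - ?free p d < ?dem p d - ?free p d"
        using lt d(1) ..
    qed (use le Suc.prems(7) in simp_all)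
    show ?thesis
    proof (rule linkage_move[OF x(1)])
      show "inj_on p (I \<times> UNIV)" by fact
      show "p x \<in> V"
        using x Suc.prems(3) by blast
      show "rook_adj (p x) (q, c)"
        using x cd by (auto simp: rook_adj_def)
      show "linkage (V - {p x}) I ?p"
      proof (rule Suc.hyps(1)[of "K - {c}"])
        show "n = card (K - {c})"
          using Suc.hyps(2) c finK by simp
        show "inj_on ?p (I \<times> UNIV)"
          by (rule inj_on_terminals_fun_upd) (use Suc.prems qc in auto)
        show "terminals I ?p \<subseteq> V - {p x}"
          unfolding T' using x qc cd Suc.prems(3) by auto
        show "W = V - {p x} - Q \<times> UNIV"
          using x q Suc.prems(6) by auto
        show "Q \<times> (K - {c}) \<subseteq> V - {p x}"
          using x qd Suc.prems(10,11) by auto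
        show "terminals I ?p \<inter> Q \<times> (K - {c}) = {}"
          unfolding T' using Suc.prems(11) by auto
        show "0 < ?free ?p c'" if "c' \<in> K - {c}" for c'
          unfolding TW using Suc.prems(12) that by auto
        show "(\<Sum>d\<in>C. ?dem ?p d - ?free ?p d) \<le> card (K - {c})"
          unfolding TW using less Suc.prems(13) c finK by simp
      qed (use Suc.prems in auto)
    qed
  qed
qed

section \<open>Deleting a single row\<close>

lemma terminals_remove:
  assumes "inj_on p (I \<times> UNIV)" "i \<in> I"
  shows "terminals (I - {i}) p = terminals I p - {p (i, b), p (i, \<not> b)}"
proof -
  have "(I - {i}) \<times> UNIV = I \<times> UNIV - {(i, b), (i, \<not> b)}"
    by auto
  also have "p ` \<dots> = terminals I p - p ` {(i, b), (i, \<not> b)}"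
    by (rule inj_on_image_set_diff[OF assms(1)]) (use assms(2) in auto)
  finally show ?thesis by simp
qed

lemma card_terminals: "inj_on p (I \<times> UNIV) \<Longrightarrow> card (terminals I p) = 2 * card I"
  by (simp add: card_image card_cartesian_product)

lemma terminals_swap: "terminals I (prod.swap \<circ> p) = prod.swap ` terminals I p"
  by (simp add: image_comp)

lemma inj_on_terminals_swap: "inj_on (prod.swap \<circ> p) A \<longleftrightarrow> inj_on p A"
  by (simp add: inj_on_def inj_eq[OF inj_swap])

text \<open>The blocked cells are those of \<open>R \<times> C - V\<close>. The 2 stands on the left
  to avoid truncated subtraction.\<close>

definition grid_linkable :: "'a set \<Rightarrow> 'b set \<Rightarrow> bool" where
  "grid_linkable R C \<longleftrightarrow>
     (\<forall>V I. V \<subseteq> R \<times> C \<and> finite I \<and> 2 * card I + card (R \<times> C - V) + 2 \<le> card R + card C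
        \<longrightarrow> linkable V I)"

lemma grid_linkable_swap:
  assumes "grid_linkable R C"
  shows "grid_linkable C R"
  unfolding grid_linkable_def linkable_def
proof (intro allI impI)
  fix V I p
  assume V: "V \<subseteq> C \<times> R \<and> finite I \<and> 2 * card I + card (C \<times> R - V) + 2 \<le> card C + card R"
    and p: "inj_on p (I \<times> UNIV) \<and> terminals I p \<subseteq> V"
  have "R \<times> C - prod.swap ` V = prod.swap ` (C \<times> R - V)"
    by force
  then have "card (R \<times> C - prod.swap ` V) = card (C \<times> R - V)"
    by (simp add: card_image)
  moreover have "prod.swap ` V \<subseteq> R \<times> C"
    using V by auto
  ultimately have "linkable (prod.swap ` V) I"
    using assms V unfolding grid_linkable_def by (simp add: add.commute)
  then have "linkage (prod.swap ` V) I (prod.swap \<circ> p)"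
    using p by (simp only: linkable_def inj_on_terminals_swap terminals_swap image_mono)
  then show "linkage V I p"
    by (rule linkage_swap)
qed

text \<open>A full column and a full row meet in one cell, so together they would need
  \<open>card R + card C - 1\<close> cells of \<open>S\<close>. In the application, \<open>S\<close>
  consists of the terminals and the blocked cells.\<close>

lemma ex_not_full_line:
  assumes "finite R" "finite C" "finite S" "card S + 2 \<le> card R + card C"
  shows "(\<forall>d\<in>C. \<exists>r\<in>R. (r, d) \<notin> S) \<or> (\<forall>r\<in>R. \<exists>d\<in>C. (r, d) \<notin> S)"
proof (rule ccontr)
  assume "\<not> ?thesis"
  then obtain r d where rd: "d \<in> C" "r \<in> R" "\<forall>r\<in>R. (r, d) \<in> S" "\<forall>d\<in>C. (r, d) \<in> S"
    by blast
  then have "R \<times> {d} \<union> {r} \<times> (C - {d}) \<subseteq> S"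
    by auto
  then have "card (R \<times> {d} \<union> {r} \<times> (C - {d})) \<le> card S"
    using assms by (intro card_mono)
  moreover have "card (R \<times> {d} \<union> {r} \<times> (C - {d})) = card (R \<times> {d}) + card ({r} \<times> (C - {d}))"
    using assms by (intro card_Un_disjoint) auto
  moreover have "0 < card C"
    using rd assms by (auto simp: card_gt_0_iff)
  ultimately show False
    using assms rd by (simp add: card_cartesian_product)
qed

text \<open>The 3 in \<open>count\<close> is the usual 2 plus one for the lost row; in return,
  blocked cells inside row \<open>r\<close> no longer count. One free cell per column is enough
  room, as a column meets row \<open>r\<close> only once.\<close>

lemma linkage_remove_row:
  assumes fin: "finite R" "finite C" "finite I" and V: "V \<subseteq> R \<times> C" and r: "r \<in> R"
    and IH: "grid_linkable (R - {r}) C"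
    and p: "inj_on p (I \<times> UNIV)" "terminals I p \<subseteq> V"
    and count: "2 * card I + card ((R - {r}) \<times> C - V) + 3 \<le> card R + card C"
    and room: "\<And>d. (r, d) \<in> terminals I p \<Longrightarrow> \<exists>r'. (r', d) \<in> V - terminals I p"
  shows "linkage V I p"
proof (rule linkage_evacuate_vertically)
  let ?T = "terminals I p" and ?W = "V - {r} \<times> UNIV"
  show finV: "finite V"
    using fin V by (meson finite_SigmaI finite_subset)
  have "(R - {r}) \<times> C - ?W = (R - {r}) \<times> C - V"
    by auto
  moreover have "0 < card R"
    using fin r by (auto simp: card_gt_0_iff)
  moreover have "?W \<subseteq> (R - {r}) \<times> C"
    using V by auto
  ultimately show "linkable ?W I"
    using IH count fin r unfolding grid_linkable_def by simp
  show "column_count (?T \<inter> {r} \<times> UNIV) d \<le> column_count (?W - ?T) d" for d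
  proof (cases "(r, d) \<in> ?T")
    case True
    then obtain r' where "(r', d) \<in> V - ?T"
      using room by blast
    \<comment> \<open>The free cell is not in row \<open>r\<close>, whose cell in column
      \<open>d\<close> holds a terminal.\<close>
    then have "(r', d) \<in> ?W - ?T"
      using True by auto
    then have "0 < column_count (?W - ?T) d"
      using finV by (auto simp: column_count_pos)
    moreover have "column_count (?T \<inter> {r} \<times> UNIV) d \<le> card {r}"
      unfolding column_count_def by (rule card_mono) auto
    ultimately show ?thesis by simp
  next
    case False
    then have "column_count (?T \<inter> {r} \<times> UNIV) d = 0"
      by (intro column_count_eq_0) auto
    then show ?thesis by simp
  qed
qed (use fin p in auto)

text \<open>The blocked cell \<open>(r, c)\<close> disappears with its row and so pays for the
  decrease of \<open>card R\<close>.\<close>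

lemma linkage_remove_blocked_row:
  assumes fin: "finite R" "finite C" "finite I" and V: "V \<subseteq> R \<times> C"
    and rc: "(r, c) \<in> R \<times> C - V"
    and IH: "grid_linkable (R - {r}) C"
    and p: "inj_on p (I \<times> UNIV)" "terminals I p \<subseteq> V"
    and count: "2 * card I + card (R \<times> C - V) + 2 \<le> card R + card C"
    and room: "\<And>d. d \<in> C \<Longrightarrow> \<exists>r'. (r', d) \<in> V - terminals I p"
  shows "linkage V I p"
proof (rule linkage_remove_row[of R C I V r])
  have "(R - {r}) \<times> C - V \<subseteq> (R \<times> C - V) - {(r, c)}"
    by auto
  then have "card ((R - {r}) \<times> C - V) \<le> card ((R \<times> C - V) - {(r, c)})"
    using fin by (intro card_mono) auto
  moreover have "0 < card (R \<times> C - V)"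
    using fin rc by (auto simp only: card_gt_0_iff finite_SigmaI finite_Diff)
  ultimately show "2 * card I + card ((R - {r}) \<times> C - V) + 3 \<le> card R + card C"
    using count rc by (simp add: card_Diff_singleton)
qed (use assms in auto)

text \<open>The path through the corner \<open>(r1, c2)\<close> has all its cells but
  \<open>(r2, c2)\<close> in row \<open>r1\<close>. Deleting that row costs one and the new blocked
  cell costs one, while the linked pair gives back two.\<close>

lemma linkage_corner:
  assumes fin: "finite R" "finite C" "finite I"
    and i: "i \<in> I" "p (i, b) = (r1, c1)" "p (i, \<not> b) = (r2, c2)" "r1 \<noteq> r2" "c1 \<noteq> c2"
    and free: "(r1, c2) \<notin> terminals I p"
    and IH: "grid_linkable (R - {r1}) C"
    and p: "inj_on p (I \<times> UNIV)" "terminals I p \<subseteq> R \<times> C"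
    and count: "2 * card I + 2 \<le> card R + card C"
    and room: "\<And>d. d \<in> C \<Longrightarrow> \<exists>r\<in>R. (r, d) \<notin> terminals I p"
  shows "linkage (R \<times> C) I p"
proof -
  let ?T = "terminals I p" and ?I = "I - {i}" and ?xs = "[(r1, c1), (r1, c2), (r2, c2)]"
  let ?V = "R \<times> C - set ?xs"
  have "(r1, c1) \<in> ?T" "(r2, c2) \<in> ?T"
    using i by (metis UNIV_I image_eqI mem_Sigma_iff)+
  then have RC: "r1 \<in> R" "c1 \<in> C" "r2 \<in> R" "c2 \<in> C"
    using p by auto
  have T': "terminals ?I p = ?T - {(r1, c1), (r2, c2)}"
    using terminals_remove[OF p(1) i(1), of b] i by simp
  have "0 < card I"
    using fin i by (auto simp: card_gt_0_iff)
  have "card ((R - {r1}) \<times> C - ?V) \<le> card {(r2, c2)}"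
    by (rule card_mono) auto
  then have count': "2 * card ?I + card ((R - {r1}) \<times> C - ?V) + 3 \<le> card R + card C"
    using count fin i \<open>0 < card I\<close> by (simp add: card_Diff_singleton)
  have "linkage ?V ?I p"
  proof (rule linkage_remove_row[OF _ _ _ _ _ IH _ _ count'])
    show "terminals ?I p \<subseteq> ?V"
      unfolding T' using p(2) free by auto
    show "inj_on p (?I \<times> UNIV)"
      using p(1) by (rule inj_on_subset) auto
    show "\<exists>r'. (r', d) \<in> ?V - terminals ?I p" if "(r1, d) \<in> terminals ?I p" for d
    proof -
      \<comment> \<open>A remaining terminal in row \<open>r1\<close> is in neither
        \<open>c1\<close> nor \<open>c2\<close>. The path stays in these two columns, so it does not
        occupy the free cell promised by \<open>room\<close>.\<close>
      have "d \<in> C" "d \<noteq> c1" "d \<noteq> c2"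
        using that free p(2) unfolding T' by auto
      then show ?thesis
        using room[of d] unfolding T' by auto
    qed
  qed (use fin RC in auto)
  moreover have "rook_path (R \<times> C) ?xs (p (i, b)) (p (i, \<not> b))"
    using RC i by (auto simp: rook_path_def rook_adj_def)
  ultimately show ?thesis
    using i linkage_join by blast
qed

section \<open>Crowded arrangements\<close>

text \<open>In a crowded arrangement every nonempty row and every nonempty column contains at least two
  terminals, so at least one row or column of the grid is empty.\<close>

definition crowded :: "nat set \<Rightarrow> (nat \<times> bool \<Rightarrow> 'a \<times> 'b) \<Rightarrow> bool" where
  "crowded I p \<longleftrightarrow> (\<forall>i\<in>I. \<forall>b. fst (p (i, b)) \<noteq> fst (p (i, \<not> b)) \<and> snd (p (i, b)) \<noteq> snd (p (i, \<not> b)) \<and>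
     (fst (p (i, b)), snd (p (i, \<not> b))) \<in> terminals I p)"

lemma crowded_swap: "crowded I p \<Longrightarrow> crowded I (prod.swap \<circ> p)"
  unfolding crowded_def
proof (intro ballI allI conjI)
  fix i b
  assume *: "\<forall>i\<in>I. \<forall>b. fst (p (i, b)) \<noteq> fst (p (i, \<not> b)) \<and> snd (p (i, b)) \<noteq> snd (p (i, \<not> b)) \<and>
    (fst (p (i, b)), snd (p (i, \<not> b))) \<in> terminals I p" and i: "i \<in> I"
  \<comment> \<open>Transposition exchanges the two corners of the bounding rectangle, so the
    condition for \<open>b\<close> becomes the one for \<open>\<not> b\<close>.\<close>
  have "(fst (p (i, \<not> b)), snd (p (i, \<not> \<not> b))) \<in> terminals I p"
    using * i by blast
  then have "prod.swap (fst (p (i, \<not> b)), snd (p (i, b))) \<in> prod.swap ` terminals I p"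
    unfolding not_not by (rule imageI)
  then show "(fst ((prod.swap \<circ> p) (i, b)), snd ((prod.swap \<circ> p) (i, \<not> b)))
      \<in> terminals I (prod.swap \<circ> p)"
    unfolding terminals_swap by simp
qed simp_all

text \<open>Next to a terminal in column \<open>d\<close>, the corner of its pair's bounding
  rectangle in that column, at the height of its partner, is occupied as well.\<close>

lemma crowded_column_count:
  assumes "crowded I p" "finite I" "column_count (terminals I p) d \<noteq> 0"
  shows "2 \<le> column_count (terminals I p) d"
proof -
  have fin: "finite (terminals I p)"
    using assms by auto
  then obtain r where "(r, d) \<in> terminals I p"
    using assms column_count_pos[OF fin] by blast
  then obtain i b where i: "i \<in> I" "p (i, b) = (r, d)"
    by auto
  let ?r = "fst (p (i, \<not> b))"
  have "(fst (p (i, \<not> b)), snd (p (i, \<not> \<not> b))) \<in> terminals I p" "fst (p (i, b)) \<noteq> ?r"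
    using assms(1) i(1) unfolding crowded_def by blast+
  then have "{r, ?r} \<subseteq> {r. (r, d) \<in> terminals I p}" "r \<noteq> ?r"
    using i \<open>(r, d) \<in> terminals I p\<close> by auto
  moreover from this(1) have "card {r, ?r} \<le> card {r. (r, d) \<in> terminals I p}"
    by (rule card_mono[OF finite_column[OF fin]])
  ultimately show ?thesis
    by (simp add: column_count_def)
qed

text \<open>Each nonempty column takes at least two of the \<open>2 * card I\<close>
  terminals.\<close>

lemma card_nonempty_columns:
  assumes "crowded I p" "finite I" "finite C" "inj_on p (I \<times> UNIV)" "terminals I p \<subseteq> R \<times> C"
  shows "card {d \<in> C. column_count (terminals I p) d \<noteq> 0} \<le> card I"
proof -
  let ?a = "column_count (terminals I p)" and ?J = "{d \<in> C. column_count (terminals I p) d \<noteq> 0}"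
  have "2 * card ?J = (\<Sum>d\<in>?J. 2)"
    by simp
  also have "\<dots> \<le> (\<Sum>d\<in>?J. ?a d)"
    using crowded_column_count[OF assms(1,2)] by (intro sum_mono) auto
  also have "\<dots> \<le> (\<Sum>d\<in>C. ?a d)"
    using assms by (intro sum_mono2) auto
  also have "\<dots> = card (terminals I p)"
    using assms by (intro card_eq_sum_column_count[symmetric]) auto
  also have "\<dots> = 2 * card I"
    using assms by (simp add: card_terminals)
  finally show ?thesis by simp
qed

text \<open>Each pair gets its own column \<open>e i\<close>: leave along the row, change rows
  inside that column, and return along the partner's row. Paths of distinct pairs use distinct empty
  columns and distinct terminals.\<close>

lemma linkage_via_empty_columns:
  assumes "finite I" "finite K" "card I \<le> card K"
    and p: "inj_on p (I \<times> UNIV)" "terminals I p \<subseteq> V"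
    and rows: "\<And>i. i \<in> I \<Longrightarrow> fst (p (i, True)) \<noteq> fst (p (i, False))"
    and K: "\<And>r d. d \<in> K \<Longrightarrow> r \<in> fst ` terminals I p \<Longrightarrow> (r, d) \<in> V - terminals I p"
  shows "linkage V I p"
proof -
  obtain e where e: "inj_on e I" "e ` I \<subseteq> K"
    using card_le_inj[OF assms(1-3)] by blast
  let ?L = "\<lambda>i. [p (i, True), (fst (p (i, True)), e i), (fst (p (i, False)), e i), p (i, False)]"
  have T: "p (i, b) \<in> terminals I p" if "i \<in> I" for i b
    using that by auto
  have cell: "(fst (p (i, b)), e j) \<in> V - terminals I p" if "i \<in> I" "j \<in> I" for i j b
    using that e(2) T by (intro K) auto
  have cell': "(fst (p (i, b)), e j) \<noteq> p (i', b')" if "i \<in> I" "j \<in> I" "i' \<in> I" for i j i' b b'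
    using cell[OF that(1,2), of b] T[OF that(3), of b'] by auto
  have neq: "p (i, b) \<noteq> p (j, b')" if "i \<in> I" "j \<in> I" "(i, b) \<noteq> (j, b')" for i j b b'
    using that p(1) by (auto simp: inj_on_def)
  have "rook_path V (?L i) (p (i, True)) (p (i, False))" if "i \<in> I" for i
  proof -
    have "set (?L i) \<subseteq> V"
      using cell[OF that that] p(2) T[OF that] by auto
    moreover have "distinct (?L i)"
      using cell'[OF that that that] cell'[OF that that that, symmetric] rows[OF that]
        neq[OF that that, of True False] by simp
    moreover have "rook_adj (p (i, True)) (fst (p (i, True)), e i)"
      "rook_adj (fst (p (i, False)), e i) (p (i, False))"
      using cell'[OF that that that] cell'[OF that that that, symmetric]
      unfolding rook_adj_def by simp_all
    moreover have "rook_adj (fst (p (i, True)), e i) (fst (p (i, False)), e i)"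
      using rows[OF that] by (simp add: rook_adj_def)
    ultimately show ?thesis
      unfolding rook_path_def by simp
  qed
  moreover have "disjoint_family_on (\<lambda>i. set (?L i)) I"
  proof (unfold disjoint_family_on_def, intro ballI impI)
    fix i j
    assume ij: "i \<in> I" "j \<in> I" "i \<noteq> j"
    then have "e i \<noteq> e j"
      using e(1) by (auto simp: inj_on_def)
    then show "set (?L i) \<inter> set (?L j) = {}"
      using cell'[OF ij(1,1,2)] cell'[OF ij(2,2,1), symmetric] neq[OF ij(1,2)] ij(3) by simp
  qed
  ultimately show ?thesis
    unfolding linkage_def by (intro exI[of _ ?L]) blast
qed

lemma column_count_split:
  assumes "finite T"
  shows "column_count T d = column_count (T \<inter> Q \<times> UNIV) d + column_count (T - Q \<times> UNIV) d"
proof -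
  have "{r. (r, d) \<in> T} = {r. (r, d) \<in> T \<inter> Q \<times> UNIV} \<union> {r. (r, d) \<in> T - Q \<times> UNIV}"
    by auto
  also have "card \<dots> = card {r. (r, d) \<in> T \<inter> Q \<times> UNIV} + card {r. (r, d) \<in> T - Q \<times> UNIV}"
    by (rule card_Un_disjoint) (use assms in \<open>auto intro: finite_subset[OF _ finite_column[OF assms]]\<close>)
  finally show ?thesis
    by (simp only: column_count_def)
qed

text \<open>The path through column \<open>c\<close> lies in two rows, so deleting both costs two
  and the linked pair gives back two. What has to be shown is that the terminals of these rows
  lacking room in their own column are at most as many as the empty columns other than
  \<open>c\<close>.\<close>

lemma linkage_crowded_empty_column:
  assumes fin: "finite R" "finite C" "finite I" and R: "3 \<le> card R"
    and IH: "\<And>Q. Q \<subseteq> R \<Longrightarrow> card Q = 2 \<Longrightarrow> grid_linkable (R - Q) C"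
    and I: "I \<noteq> {}" and p: "inj_on p (I \<times> UNIV)" "terminals I p \<subseteq> R \<times> C"
    and count: "2 * card I + 2 \<le> card R + card C"
    and crowded: "crowded I p"
    and c: "c \<in> C" "column_count (terminals I p) c = 0"
  shows "linkage (R \<times> C) I p"
proof -
  let ?T = "terminals I p"
  let ?a = "column_count ?T"
  have finT: "finite ?T"
    using fin by auto
  \<comment> \<open>Only columns with at least \<open>card R - 1\<close> terminals can lack room. If
    there is one, the pair is chosen with a terminal in such a column: the deficit there is then
    exactly \<open>?a c1 + 1 - card R\<close>, which brings \<open>card R\<close> into the final
    estimate.\<close>
  obtain i b where i: "i \<in> I"
    and heavy: "(\<exists>d. card R \<le> ?a d + 1) \<Longrightarrow> card R \<le> ?a (snd (p (i, b))) + 1"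
  proof (cases "\<exists>d. card R \<le> ?a d + 1")
    case True
    then obtain d where d: "card R \<le> ?a d + 1"
      by blast
    then have "0 < ?a d"
      using R by linarith
    then obtain r where "(r, d) \<in> ?T"
      using column_count_pos[OF finT] by blast
    then obtain i b where "i \<in> I" "p (i, b) = (r, d)"
      by auto
    then show ?thesis
      using that[of i b] d by simp
  next
    case False
    then show ?thesis
      using that I by blast
  qed
  obtain r1 c1 where p1: "p (i, b) = (r1, c1)"
    by fastforce
  obtain r2 c2 where p2: "p (i, \<not> b) = (r2, c2)"
    by fastforce
  have "fst (p (i, b)) \<noteq> fst (p (i, \<not> b)) \<and> snd (p (i, b)) \<noteq> snd (p (i, \<not> b))"
    using crowded i unfolding crowded_def by blast
  then have neq: "r1 \<noteq> r2" "c1 \<noteq> c2"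
    using p1 p2 by simp_all
  have T12: "(r1, c1) \<in> ?T" "(r2, c2) \<in> ?T"
    using i p1 p2 by (metis UNIV_I image_eqI mem_Sigma_iff)+
  then have RC: "r1 \<in> R" "c1 \<in> C" "r2 \<in> R" "c2 \<in> C"
    using p by auto
  define Q where "Q = {r1, r2}"
  define J where "J = {d \<in> C. ?a d \<noteq> 0}"
  \<comment> \<open>The empty columns left for detours; \<open>c\<close> is excluded because the
    path occupies it in both rows of \<open>Q\<close>.\<close>
  define K where "K = C - J - {c}"
  let ?xs = "[(r1, c1), (r1, c), (r2, c), (r2, c2)]"
  let ?V = "R \<times> C - set ?xs"
  let ?W = "?V - Q \<times> UNIV"
  let ?I = "I - {i}"
  let ?T' = "terminals ?I p"
  let ?dem = "column_count (?T' \<inter> Q \<times> UNIV)" and ?free = "column_count (?W - ?T')"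
  have T': "?T' = ?T - {(r1, c1), (r2, c2)}"
    using terminals_remove[OF p(1) i, of b] p1 p2 by simp
  have Q: "Q \<subseteq> R" "card Q = 2"
    using RC neq by (auto simp: Q_def)
  have W: "?W = (R - Q) \<times> C"
    by (auto simp: Q_def)
  have cJ: "c \<notin> J" "J \<subseteq> C"
    using c by (auto simp: J_def)
  have c12: "c1 \<in> J" "c2 \<in> J"
    using RC T12 column_count_pos[OF finT] unfolding J_def by blast+
  have c_neq: "c \<noteq> c1" "c \<noteq> c2"
    using c12 cJ by auto
  have empty: "(r, d) \<notin> ?T" if "?a d = 0" for r d
    using that column_count_pos[OF finT, of d] by auto
  have card_I: "0 < card I"
    using fin I by (simp add: card_gt_0_iff)
  have card_K: "card K = card C - card J - 1"
    unfolding K_def using cJ c(1) fin by (simp add: card_Diff_subset finite_subset)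
  have free: "?free d + column_count (?T - Q \<times> UNIV) d = card R - 2" if "d \<in> C" for d
  proof -
    have "{r. (r, d) \<in> ?W - ?T'} = (R - Q) - {r. (r, d) \<in> ?T - Q \<times> UNIV}"
      unfolding T' using that by (auto simp: Q_def)
    moreover have sub: "{r. (r, d) \<in> ?T - Q \<times> UNIV} \<subseteq> R - Q"
      using p(2) by auto
    moreover have "card (R - Q) = card R - 2"
      using Q fin by (simp add: card_Diff_subset finite_subset)
    moreover have "card {r. (r, d) \<in> ?T - Q \<times> UNIV} \<le> card (R - Q)"
      using fin sub by (intro card_mono) auto
    ultimately show ?thesis
      unfolding column_count_def using fin
      by (simp add: card_Diff_subset finite_column finT)
  qed
  have "?T' \<inter> Q \<times> UNIV = (?T \<inter> Q \<times> UNIV) - {(r1, c1)} - {(r2, c2)}"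
    unfolding T' by auto
  then have "column_count (?T \<inter> Q \<times> UNIV) d = ?dem d + (if d = c1 then 1 else 0) + (if d = c2 then 1 else 0)" for d
    using column_count_remove[of "?T \<inter> Q \<times> UNIV" r1 c1 d]
      column_count_remove[of "(?T \<inter> Q \<times> UNIV) - {(r1, c1)}" r2 c2 d] finT T12 neq
    by (simp add: Q_def)
  \<comment> \<open>Over the integers, \<open>?dem d - ?free d\<close> is
    \<open>?a d + 2 - card R\<close>, lowered by one in the columns of the linked pair.\<close>
  then have a: "?a d + ?free d + 2 = ?dem d + (if d = c1 \<or> d = c2 then 1 else 0) + card R" if "d \<in> C" for d
    using free[OF that] column_count_split[OF finT, of d Q] neq R by auto
  have a2: "2 \<le> ?a d" if "d \<in> J" for d
    using crowded_column_count[OF crowded fin(3)] that by (auto simp: J_def)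
  have room: "(\<Sum>d\<in>C. ?dem d - ?free d) \<le> card K"
  proof (cases "\<exists>d. card R \<le> ?a d + 1")
    case False
    then have "\<not> card R \<le> ?a d + 1" for d
      by blast
    then have "?dem d - ?free d = 0" if "d \<in> C" for d
    proof -
      have "?dem d + card R \<le> ?a d + ?free d + 2" "\<not> card R \<le> ?a d + 1"
        using a[OF that] \<open>\<And>d. \<not> card R \<le> ?a d + 1\<close> by simp_all
      then show ?thesis by linarith
    qed
    then show ?thesis by simp
  next
    case True
    then have a1: "card R \<le> ?a c1 + 1"
      using heavy p1 by simp
    let ?J = "J - {c1, c2}"
    have J: "J = insert c1 (insert c2 ?J)" and finJ: "finite ?J"
      using c12 fin by (auto simp: J_def)
    have cardJ: "card J = card ?J + 2"
      using neq finJ by (subst J) simp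
    have sumJ: "(\<Sum>d\<in>C. f d) = f c1 + f c2 + (\<Sum>d\<in>?J. f d)"
      if "\<And>d. d \<in> C - J \<Longrightarrow> f d = 0" for f :: "'b \<Rightarrow> nat"
    proof -
      have "(\<Sum>d\<in>C. f d) = (\<Sum>d\<in>J. f d)"
        using that cJ fin by (intro sum.mono_neutral_right) auto
      then show ?thesis
        using neq finJ by (subst (asm) J) simp
    qed
    have "?dem d - ?free d = 0" if "d \<in> C - J" for d
    proof -
      have "?a d = 0"
        using that by (auto simp: J_def)
      then have "?dem d = 0"
        using empty unfolding T' by (intro column_count_eq_0) blast
      then show ?thesis by simp
    qed
    from sumJ[OF this] have "(\<Sum>d\<in>C. ?dem d - ?free d) =
        (?dem c1 - ?free c1) + (?dem c2 - ?free c2) + (\<Sum>d\<in>?J. ?dem d - ?free d)"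
      by simp
    moreover have "2 * card I = ?a c1 + ?a c2 + (\<Sum>d\<in>?J. ?a d)"
    proof -
      have "2 * card I = card ?T"
        using p(1) by (rule card_terminals[symmetric])
      also have "\<dots> = (\<Sum>d\<in>C. ?a d)"
        by (rule card_eq_sum_column_count[OF finT fin(2)]) (use p(2) in auto)
      also have "\<dots> = ?a c1 + ?a c2 + (\<Sum>d\<in>?J. ?a d)"
        by (rule sumJ) (simp add: J_def)
      finally show ?thesis .
    qed
    moreover have "?dem c1 - ?free c1 + card R = ?a c1 + 1"
      using a[of c1] RC a1 by auto
    moreover have "?dem c2 - ?free c2 + 2 \<le> ?a c2"
      using a[of c2] RC R a2[OF c12(2)] by auto
    moreover have "(\<Sum>d\<in>?J. ?dem d - ?free d) + card ?J \<le> (\<Sum>d\<in>?J. ?a d)"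
    proof -
      have "?dem d - ?free d + 1 \<le> ?a d" if "d \<in> ?J" for d
        using a[of d] that cJ R a2[of d] by auto
      then have "(\<Sum>d\<in>?J. ?dem d - ?free d + 1) \<le> (\<Sum>d\<in>?J. ?a d)"
        by (intro sum_mono)
      then show ?thesis
        by (simp only: sum.distrib sum_constant) simp
    qed
    \<comment> \<open>The deficit is \<open>?a c1 + 1 - card R\<close> in \<open>c1\<close>, at most
      \<open>?a c2 - 2\<close> in \<open>c2\<close>, and at most \<open>?a d - 1\<close> in each
      other nonempty column. The total is at most \<open>2 * card I + 1 - card R - card J\<close>,
      and \<open>count\<close> bounds this by \<open>card C - card J - 1 = card K\<close>.\<close>
    ultimately show ?thesis
      using card_K cardJ count by linarith
  qed
  have "linkage ?V ?I p"
  proof (rule linkage_evacuate[where W = ?W and Q = Q and C = C and K = K])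
    \<comment> \<open>All cells of the path lie in the rows \<open>Q\<close>, so the remaining grid
      has no blocked cell.\<close>
    have "card ((R - Q) \<times> C - ?W) = 0"
      unfolding W by simp
    moreover have "card ?I = card I - 1"
      using i fin by (simp add: card_Diff_singleton)
    moreover have "card (R - Q) = card R - 2"
      using Q fin by (simp add: card_Diff_subset finite_subset)
    ultimately have "2 * card ?I + card ((R - Q) \<times> C - ?W) + 2 \<le> card (R - Q) + card C"
      using count card_I R by linarith
    then show "linkable ?W ?I"
      by (intro IH[OF Q, unfolded grid_linkable_def, rule_format] conjI equalityD1[OF W]
          finite_Diff fin(3))
    show "inj_on p (?I \<times> UNIV)"
      using p(1) by (rule inj_on_subset) auto
    show "?T' \<subseteq> ?V"
      unfolding T' using p(2) empty[OF c(2)] by auto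
    show "Q \<times> K \<subseteq> ?V"
      using Q c12 by (auto simp: K_def)
    show "?T' \<inter> Q \<times> K = {}"
      unfolding T' K_def J_def using empty by auto
    show "0 < ?free d" if "d \<in> K" for d
    proof -
      have d: "d \<in> C" "?a d = 0"
        using that by (auto simp: K_def J_def)
      then have "column_count (?T - Q \<times> UNIV) d = 0"
        using empty by (intro column_count_eq_0) blast
      then show ?thesis
        using free[OF d(1)] R by simp
    qed
    show "(\<Sum>d\<in>C. ?dem d - ?free d) \<le> card K"
      by (rule room)
  qed (use fin in \<open>auto simp: K_def\<close>)
  moreover have "rook_path (R \<times> C) ?xs (p (i, b)) (p (i, \<not> b))"
    using RC c(1) c_neq neq p1 p2 by (auto simp: rook_path_def rook_adj_def)
  ultimately show ?thesis
    using i linkage_join by blast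
qed

lemma linkage_crowded:
  assumes fin: "finite R" "finite C" "finite I"
    and IH: "\<And>Q. Q \<subseteq> R \<Longrightarrow> card Q = 2 \<Longrightarrow> grid_linkable (R - Q) C"
    and I: "I \<noteq> {}" and p: "inj_on p (I \<times> UNIV)" "terminals I p \<subseteq> R \<times> C"
    and count: "2 * card I + 2 \<le> card R + card C"
    and crowded: "crowded I p"
    and c: "c \<in> C" "column_count (terminals I p) c = 0"
  shows "linkage (R \<times> C) I p"
proof (cases "3 \<le> card R")
  case True
  show ?thesis
    by (rule linkage_crowded_empty_column[OF fin True IH I p count crowded c])
next
  case False
  let ?T = "terminals I p"
  let ?J = "{d \<in> C. column_count ?T d \<noteq> 0}"
  have finT: "finite ?T"
    using fin by auto
  show ?thesis
  proof (rule linkage_via_empty_columns[of I "C - ?J"])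
    \<comment> \<open>With at most two rows, \<open>count\<close> gives
      \<open>2 * card I \<le> card C\<close>. Since at most \<open>card I\<close> columns are
      nonempty, at least \<open>card I\<close> are empty.\<close>
    have "card ?J \<le> card I"
      by (rule card_nonempty_columns[OF crowded fin(3,2) p])
    moreover have "card (C - ?J) = card C - card ?J"
      using fin by (intro card_Diff_subset) auto
    ultimately show "card I \<le> card (C - ?J)"
      using count False by linarith
    show "fst (p (i, True)) \<noteq> fst (p (i, False))" if "i \<in> I" for i
      using crowded that unfolding crowded_def by (metis (full_types))
    show "(r, d) \<in> R \<times> C - ?T" if d: "d \<in> C - ?J" and r: "r \<in> fst ` ?T" for r d
    proof -
      obtain u where "u \<in> ?T" "r = fst u"
        using r by (rule imageE)
      then have "r \<in> R"
        using subsetD[OF p(2)] by (simp add: mem_Times_iff)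
      moreover have "d \<in> C" "(r, d) \<notin> ?T"
        using d column_count_pos[OF finT, of d] by auto
      ultimately show ?thesis
        by blast
    qed
  qed (use fin p in auto)
qed

section \<open>The induction over grids\<close>

lemma grid_linkable:
  assumes "finite R" "finite C"
  shows "grid_linkable R C"
  using assms
proof (induction "card R + card C" arbitrary: R C rule: less_induct)
  case less
  have IHR: "grid_linkable R' C" if "R' \<subset> R" for R'
    using less.prems psubset_card_mono[OF less.prems(1) that] finite_subset[OF psubset_imp_subset[OF that]]
    by (intro less.hyps) simp_all
  \<comment> \<open>Deleting columns means deleting rows of the transposed grid, hence the exchanged
    arguments.\<close>
  have IHC: "grid_linkable C' R" if "C' \<subset> C" for C'
    using less.prems psubset_card_mono[OF less.prems(2) that] finite_subset[OF psubset_imp_subset[OF that]]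
    by (intro grid_linkable_swap[OF less.hyps]) simp_all
  have "linkage V I p"
    if "finite I" "V \<subseteq> R \<times> C" "2 * card I + card (R \<times> C - V) + 2 \<le> card R + card C"
      "inj_on p (I \<times> UNIV)" "terminals I p \<subseteq> V" for V I p
    using that
  \<comment> \<open>The inner induction serves the case of adjacent terminals: the grid stays the
    same, \<open>card I\<close> drops by one and at most two more cells become blocked, so the bound
    persists.\<close>
  proof (induction "card I" arbitrary: V I rule: less_induct)
    case inner: less
    let ?T = "terminals I p"
    note fin = less.prems inner.prems(1)
    note V = inner.prems(2) and count = inner.prems(3) and p = inner.prems(4,5)
    have finV: "finite V"
      using V fin by (meson finite_SigmaI finite_subset)
    consider (empty) "I = {}"
      | (adjacent) i where "i \<in> I" "rook_adj (p (i, True)) (p (i, False))"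
      | (far) "I \<noteq> {}" "\<And>i. i \<in> I \<Longrightarrow> \<not> rook_adj (p (i, True)) (p (i, False))"
      by blast
    then show ?case
    proof cases
      case empty
      then show ?thesis by simp
    next
      case adjacent
      let ?xs = "[p (i, True), p (i, False)]"
      have card_I: "card I = card (I - {i}) + 1"
        using fin adjacent by (metis Suc_eq_plus1 card_Suc_Diff1)
      have sub: "?xs ! 0 \<in> V" "?xs ! 1 \<in> V"
        using p adjacent by auto
      have "linkage (V - set ?xs) (I - {i}) p"
      proof (rule inner.hyps)
        have "R \<times> C - (V - set ?xs) \<subseteq> (R \<times> C - V) \<union> set ?xs"
          by auto
        then have "card (R \<times> C - (V - set ?xs)) \<le> card ((R \<times> C - V) \<union> set ?xs)"
          using fin by (intro card_mono) auto
        also have "\<dots> \<le> card (R \<times> C - V) + length ?xs"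
          by (rule order_trans[OF card_Un_le add_left_mono[OF card_length]])
        finally show "2 * card (I - {i}) + card (R \<times> C - (V - set ?xs)) + 2 \<le> card R + card C"
          using count card_I by simp
        have "terminals (I - {i}) p = ?T - set ?xs"
          using terminals_remove[OF p(1) adjacent(1), of True] by simp
        then show "terminals (I - {i}) p \<subseteq> V - set ?xs"
          using p(2) by (simp only: Diff_mono subset_refl)
        show "inj_on p ((I - {i}) \<times> UNIV)"
          using p(1) by (rule inj_on_subset) auto
      qed (use fin V card_I in auto)
      moreover have "rook_path V ?xs (p (i, True)) (p (i, \<not> True))"
        using adjacent(2) sub by (auto simp: rook_path_def rook_adj_def)
      ultimately show ?thesis
        using linkage_join adjacent(1) by blast
    next
      case far
      have neq: "fst (p (i, b)) \<noteq> fst (p (i, \<not> b)) \<and> snd (p (i, b)) \<noteq> snd (p (i, \<not> b))"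
        if "i \<in> I" for i b
      proof -
        have "p (i, True) \<noteq> p (i, False)"
          using p(1) that by (auto simp: inj_on_def)
        then show ?thesis
          using far(2)[OF that] by (cases b) (auto simp: rook_adj_def)
      qed
      have swapped: "prod.swap ` V \<subseteq> C \<times> R" "inj_on (prod.swap \<circ> p) (I \<times> UNIV)"
        "terminals I (prod.swap \<circ> p) \<subseteq> prod.swap ` V"
        using V p by (auto simp: inj_on_terminals_swap terminals_swap simp del: o_apply)
      have T_card: "card ?T = 2 * card I"
        using p(1) by (rule card_terminals)
      let ?S = "?T \<union> (R \<times> C - V)"
      have "card ?S \<le> card ?T + card (R \<times> C - V)"
        by (rule card_Un_le)
      then have "card ?S + 2 \<le> card R + card C"
        using count T_card by linarith
      moreover have "finite ?S"
        using fin by simp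
      ultimately have "(\<forall>d\<in>C. \<exists>r\<in>R. (r, d) \<notin> ?S) \<or> (\<forall>r\<in>R. \<exists>d\<in>C. (r, d) \<notin> ?S)"
        by (intro ex_not_full_line[OF fin(1,2)])
      then have line: "(\<forall>d\<in>C. \<exists>r\<in>R. (r, d) \<in> V - ?T) \<or> (\<forall>r\<in>R. \<exists>d\<in>C. (r, d) \<in> V - ?T)"
        by (rule disj_forward) fast+
      show ?thesis
      proof (cases "V = R \<times> C")
        case False
        then obtain r c where rc: "(r, c) \<in> R \<times> C - V"
          using V by auto
        show ?thesis
          using line
        proof
          assume column: "\<forall>d\<in>C. \<exists>r\<in>R. (r, d) \<in> V - ?T"
          show ?thesis
            by (rule linkage_remove_blocked_row[OF fin V rc IHR p count])
              (use rc column in blast)+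
        next
          assume row: "\<forall>r\<in>R. \<exists>d\<in>C. (r, d) \<in> V - ?T"
          have "C \<times> R - prod.swap ` V = prod.swap ` (R \<times> C - V)"
            by force
          then have card: "card (C \<times> R - prod.swap ` V) = card (R \<times> C - V)"
            by (simp add: card_image)
          have "linkage (prod.swap ` V) I (prod.swap \<circ> p)"
          proof (rule linkage_remove_blocked_row[OF fin(2,1,3) swapped(1) _ IHC swapped(2,3)])
            show "(c, r) \<in> C \<times> R - prod.swap ` V" "C - {c} \<subset> C"
              using rc by auto
            show "\<exists>r'. (r', d) \<in> prod.swap ` V - terminals I (prod.swap \<circ> p)" if "d \<in> R" for d
              using bspec[OF row that] unfolding terminals_swap by auto
          qed (use count card in simp)
          then show ?thesis
            by (rule linkage_swap)
        qed
      next
        case VRC: True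
        have count': "2 * card I + 2 \<le> card R + card C"
          using count by simp
        have swap_RC: "prod.swap ` (R \<times> C) = C \<times> R"
          by auto
        show ?thesis
        proof (cases "crowded I p")
          case False
          then obtain i b where i: "i \<in> I" and free: "(fst (p (i, b)), snd (p (i, \<not> b))) \<notin> ?T"
            using neq unfolding crowded_def by blast
          obtain r1 c1 where p1: "p (i, b) = (r1, c1)"
            by fastforce
          obtain r2 c2 where p2: "p (i, \<not> b) = (r2, c2)"
            by fastforce
          have ne: "r1 \<noteq> r2" "c1 \<noteq> c2"
            using neq[OF i, of b] p1 p2 by auto
          have "(r1, c1) \<in> ?T" "(r2, c2) \<in> ?T"
            using i p1 p2 by (metis UNIV_I image_eqI mem_Sigma_iff)+
          then have RC: "r1 \<in> R" "c2 \<in> C"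
            using p V by auto
          show ?thesis
            using line
          proof
            assume column: "\<forall>d\<in>C. \<exists>r\<in>R. (r, d) \<in> V - ?T"
            have "linkage (R \<times> C) I p"
              by (rule linkage_corner[OF fin i p1 p2 ne _ IHR p(1) _ count'])
                (use free p1 p2 RC p(2) VRC column in auto)
            then show ?thesis
              using VRC by simp
          next
            assume row: "\<forall>r\<in>R. \<exists>d\<in>C. (r, d) \<in> V - ?T"
            \<comment> \<open>After transposition the free corner lies in row \<open>c2\<close>, the
              row of the terminal with index \<open>\<not> b\<close>, so the two terminals exchange
              roles.\<close>
            have "linkage (C \<times> R) I (prod.swap \<circ> p)"
            proof (rule linkage_corner[OF fin(2,1,3) i, where b = "\<not> b"])
              show "(prod.swap \<circ> p) (i, \<not> b) = (c2, r2)" "(prod.swap \<circ> p) (i, \<not> \<not> b) = (c1, r1)"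
                using p1 p2 by simp_all
              show "(c2, r1) \<notin> terminals I (prod.swap \<circ> p)"
                unfolding terminals_swap using free p1 p2 by auto
              show "grid_linkable (C - {c2}) R"
                using IHC RC by blast
              show "\<exists>r\<in>C. (r, d) \<notin> terminals I (prod.swap \<circ> p)" if "d \<in> R" for d
                using bspec[OF row that] unfolding terminals_swap by auto
            qed (use ne swapped swap_RC VRC count' in auto)
            then show ?thesis
              using VRC swap_RC linkage_swap by metis
          qed
        next
          case True
          let ?J = "{d \<in> C. column_count ?T d \<noteq> 0}"
          let ?J' = "{d \<in> R. column_count (terminals I (prod.swap \<circ> p)) d \<noteq> 0}"
          have J: "card ?J \<le> card I"
            by (rule card_nonempty_columns[OF True fin(3,2) p(1)]) (use p V in blast)
          have J': "card ?J' \<le> card I"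
            by (rule card_nonempty_columns[OF crowded_swap[OF True] fin(3,1) swapped(2)])
              (use swapped in blast)
          \<comment> \<open>If no line were empty, both \<open>card R\<close> and
            \<open>card C\<close> would be at most \<open>card I\<close>, against
            \<open>2 * card I + 2 \<le> card R + card C\<close>.\<close>
          have "?J \<noteq> C \<or> ?J' \<noteq> R"
          proof (rule ccontr)
            assume "\<not> ?thesis"
            then have "card C \<le> card I" "card R \<le> card I"
              using J J' by simp_all
            then show False
              using count by linarith
          qed
          then consider (C) c where "c \<in> C" "column_count ?T c = 0"
            | (R) r where "r \<in> R" "column_count (terminals I (prod.swap \<circ> p)) r = 0"
            by blast
          then show ?thesis
          proof cases
            case C
            have "linkage (R \<times> C) I p"
            proof (rule linkage_crowded[OF fin _ far(1) p(1) _ count' True C])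
              show "grid_linkable (R - Q) C" if "Q \<subseteq> R" "card Q = 2" for Q
              proof (rule IHR)
                have "Q \<noteq> {}"
                  using that(2) by auto
                then show "R - Q \<subset> R"
                  using that(1) by blast
              qed
            qed (use p VRC in simp)
            then show ?thesis
              using VRC by simp
          next
            case R
            have "linkage (C \<times> R) I (prod.swap \<circ> p)"
            proof (rule linkage_crowded[OF fin(2,1,3) _ far(1) swapped(2) _ _ crowded_swap[OF True] R])
              show "grid_linkable (C - Q) R" if "Q \<subseteq> C" "card Q = 2" for Q
              proof (rule IHC)
                have "Q \<noteq> {}"
                  using that(2) by auto
                then show "C - Q \<subset> C"
                  using that(1) by blast
              qed
            qed (use swapped VRC swap_RC count' in auto)
            then show ?thesis
              using VRC swap_RC linkage_swap by metis
          qed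
        qed
      qed
    qed
  qed
  then show ?case
    unfolding grid_linkable_def linkable_def by blast
qed

section \<open>Transfer to the product of complete graphs\<close>

text \<open>In complete factors distinct coordinates are always adjacent, so every rook move is an
  arc of the product.\<close>

lemma rook_walk_arcs:
  assumes "parcs G1 = {(u, v). (u, v) \<in> pverts G1 \<times> pverts G1 \<and> u \<noteq> v}"
    and "parcs G2 = {(u, v). (u, v) \<in> pverts G2 \<times> pverts G2 \<and> u \<noteq> v}"
    and "set xs \<subseteq> pverts G1 \<times> pverts G2" "successively rook_adj xs"
  shows "set (vwalk_arcs xs) \<subseteq> parcs (cartesian_product G1 G2)"
  using assms(3,4)
  by (induction xs rule: vwalk_arcs.induct)
    (auto simp: assms(1,2) cartesian_product_def rook_adj_def)

theorem theorem2:
  fixes d1 d2 :: nat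
    and G1 :: "'a pair_pre_digraph" and G2 :: "'b pair_pre_digraph"
  assumes "complete_digraph (d1 + 1) (with_proj G1)"
    and "complete_digraph (d2 + 1) (with_proj G2)"
  shows "linked ((d1 + d2) div 2) (with_proj (cartesian_product G1 G2))"
proof -
  let ?k = "(d1 + d2) div 2" and ?G = "cartesian_product G1 G2"
  let ?I = "{1..?k}"
  have G1: "finite (pverts G1)" "card (pverts G1) = d1 + 1"
      "parcs G1 = {(u, v). (u, v) \<in> pverts G1 \<times> pverts G1 \<and> u \<noteq> v}"
    and G2: "finite (pverts G2)" "card (pverts G2) = d2 + 1"
      "parcs G2 = {(u, v). (u, v) \<in> pverts G2 \<times> pverts G2 \<and> u \<noteq> v}"
    using assms unfolding complete_digraph_pair_def by blast+
  have V: "pverts ?G = pverts G1 \<times> pverts G2"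
    by (simp add: cartesian_product_def)
  \<comment> \<open>With no blocked cell, the bound reads
    \<open>2 * ?k + 2 \<le> (d1 + 1) + (d2 + 1)\<close>, which holds because \<open>?k\<close> is
    rounded down.\<close>
  have "linkable (pverts ?G) ?I"
    using grid_linkable[OF G1(1) G2(1)] G1 G2 unfolding grid_linkable_def V by simp
  note link = this[unfolded linkable_def, rule_format]
  show ?thesis
    unfolding linked_def with_proj_simps
  proof (intro conjI allI impI)
    show "2 * ?k \<le> card (pverts ?G)"
      unfolding V by (simp add: card_cartesian_product G1 G2)
    fix X and s t :: "nat \<Rightarrow> 'a \<times> 'b"
    assume asm: "X \<subseteq> pverts ?G \<and> card X = 2 * ?k \<and> (\<Union>i\<in>?I. {s i, t i}) = X \<and>
      disjoint_family_on (\<lambda>i. {s i, t i}) ?I \<and> (\<forall>i\<in>?I. s i \<noteq> t i)"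
    \<comment> \<open>Disjointness of the pairs together with \<open>s i \<noteq> t i\<close> will
      amount to injectivity of this single map.\<close>
    define p where "p = (\<lambda>(i, b). if b then s i else t i)"
    have disj: "{s i, t i} \<inter> {s j, t j} = {}" if "i \<in> ?I" "j \<in> ?I" "i \<noteq> j" for i j
      using asm that unfolding disjoint_family_on_def by blast
    have inj: "inj_on p (?I \<times> UNIV)"
    proof (rule inj_onI)
      fix x y
      assume xy: "x \<in> ?I \<times> UNIV" "y \<in> ?I \<times> UNIV" "p x = p y"
      obtain i b j b' where ij: "x = (i, b)" "y = (j, b')"
        by fastforce
      have "i = j"
        using disj[of i j] xy unfolding ij p_def by (auto split: if_splits)
      moreover have "s i \<noteq> t i"
        using asm xy(1) unfolding ij by blast
      ultimately show "x = y"
        using xy(3) unfolding ij p_def by (auto split: if_splits)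
    qed
    have sub: "terminals ?I p \<subseteq> (\<Union>i\<in>?I. {s i, t i})"
    proof (rule image_subsetI)
      show "p x \<in> (\<Union>i\<in>?I. {s i, t i})" if "x \<in> ?I \<times> UNIV" for x
        using that by (intro UN_I[of "fst x"]) (auto simp: p_def)
    qed
    have "(\<Union>i\<in>?I. {s i, t i}) \<subseteq> pverts ?G"
      using asm by simp
    with sub have "terminals ?I p \<subseteq> pverts ?G"
      by (rule subset_trans)
    then have "linkage (pverts ?G) ?I p"
      by (rule link[OF conjI[OF inj]])
    then obtain L where
      L: "\<forall>i\<in>?I. rook_path (pverts ?G) (L i) (p (i, True)) (p (i, False))"
        "disjoint_family_on (\<lambda>i. set (L i)) ?I"
      unfolding linkage_def by blast
    have "vpath (L i) (with_proj ?G) \<and> hd (L i) = s i \<and> last (L i) = t i" if "i \<in> ?I" for i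
      using L(1)[rule_format, OF that] rook_walk_arcs[OF G1(3) G2(3), of "L i"]
      by (simp add: rook_path_def vpath_def vwalk_def p_def V)
    then show "\<exists>L. (\<forall>i\<in>?I. vpath (L i) (with_proj ?G) \<and> hd (L i) = s i \<and> last (L i) = t i) \<and>
        disjoint_family_on (\<lambda>i. set (L i)) ?I"
      using L(2) by blast
  qed
qed

end
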